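(* The tableau calculus $\mathbf{TAB}_{\mathbf{TO}}$ has the termination property; that is, for every formula $\varphi$ and every nominal $i$ not occurring in $\varphi$, every tableau in $\mathbf{TAB}_{\mathbf{TO}}$ with root formula $@_i\varphi$ is finite.
   Context: **Formulas.** Let $\mathbf{Prop}$ (propositional variables) and $\mathbf{Nom}$ (nominals) be disjoint countably infinite sets. Formulas are $\varphi ::= p \mid i \mid \neg\varphi \mid \varphi\land\varphi \mid \varphi\lor\varphi \mid \Diamond\varphi \mid \Box\varphi \mid @_i\varphi$ with $p\in\mathbf{Prop}$, $i\in\mathbf{Nom}$. All formulas are taken in negation normal form (NNF: negation only in front of propositional variables and nominals; $\neg @_i\varphi$ is rewritten as $@_i\neg\varphi$, Boolean and modal operators as usual), and $\neg\varphi$ denotes the NNF of the negation of $\varphi$. **Tableaus.** A tableau is a tree of formulas, built downwards from a root formula $@_i\varphi$, where $i\in\mathbf{Nom}$ does not occur in $\varphi$, by extending branches with the rules below (branches may a priori be infinite). We write $\varphi\in\Theta$ if $\varphi$ occurs in the branch $\Theta$. A branch $\Theta$ is closed if $@_i\varphi, @_i\neg\varphi\in\Theta$ for some $\varphi$, $i$; otherwise it is open. A closed branch is not extended, nor is a branch on which every formula that could be generated by applying a rule already exists; rules are not applied redundantly: each application must add a formula not already on the branch to every branch it produces. **Rules of $\mathbf{TAB}_{\mathbf{TO}}$** (premises are on the branch; conclusions are added to it). "Accessibility formula" means a formula $@_i\Diamond j$ added by $[\Diamond]$ (with $j$ new), a formula $@_i\Diamond i$ added by $[Ref]$, or a formula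 $@_i\Diamond j$ or $@_j\Diamond i$ added by $[Tot]$. - $[Eq]$: add $@_i i$, for any nominal $i$ already occurring in the branch. - $[\land]$: from $@_i(\varphi\land\psi)$ add $@_i\varphi$ and $@_i\psi$. - $[\lor]$: from $@_i(\varphi\lor\psi)$ split the branch, adding $@_i\varphi$ on one side and $@_i\psi$ on the other. - $[\Diamond]$: from $@_i\Diamond\varphi$ which is not an accessibility formula, add $@_i\Diamond j$ and $@_j\varphi$, where $j$ is a nominal not occurring in the branch; it is applied at most once per formula. - $[\Box]$: from $@_i\Box\varphi$ and $@_i\Diamond j$ add $@_j\varphi$. - $[@]$: from $@_i@_j\varphi$ add $@_j\varphi$. - $[Id]$: from $@_i\varphi$, not an accessibility formula, and $@_i j$ add $@_j\varphi$. - $[Ref]$: add $@_i\Diamond i$, for any nominal $i$ already occurring in the branch. - $[A\text{-}sym]$: add $@_i\Box(i\lor\Box\neg i)$, for any nominal $i$ already occurring in the branch. - $[Trs]$: from $@_i\Box\varphi$ and $@_i\Diamond j$ add $@_j\Box\varphi$. - $[Tot]$: for any nominals $i,j$ already occurring in the branch, split the branch, adding $@_i\Diamond j$ on one side and $@_j\Diamond i$ on the other. - Restriction $(\mathcal D)$: $[\Diamond]$ can be applied to $@_i\Diamond\varphi$ on a branch $\Theta$ only if $i$ is a quasi-urfather on $\Theta$ (at the moment of application). **Quasi-urfathers.** $@_i\varphi$ is a prefixed subformula of $@_j\psi$ if $\varphi$ is a subformula of $\psi$. For a nominal $i$ occurring in $\Theta$, $T^\Theta(i)=T_1^\Theta(i)\cup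 T_2^\Theta(i)$, where $T_1^\Theta(i)$ is the set of $\varphi$ such that $@_i\varphi\in\Theta$ is a prefixed subformula of the root formula of $\Theta$, and $T_2^\Theta(i)$ is the set of $\psi$ such that $@_i\psi\in\Theta$ is a prefixed subformula of $@_j\Box(j\lor\Box\neg j)$ for some $j$ occurring in the root formula. Nominals $i,j$ are twins in $\Theta$ if $T^\Theta(i)=T^\Theta(j)$. Write $i\prec_\Theta j$ if $j$ is introduced in $\Theta$ by applying $[\Diamond]$ to some $@_i\Diamond\varphi$; $\prec_\Theta^*$ is the reflexive transitive closure. A nominal $i$ is a quasi-urfather on $\Theta$ if there are no twins $j\neq k$ with $j\prec_\Theta^* i$ and $k\prec_\Theta^* i$. *)

theory Defs
  imports Main
begin

section \<open>Formulas\<close>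

text \<open>Propositional variables and nominals are two copies of the natural numbers, kept
  apart by the constructors \<open>Pro\<close> and \<open>Nom\<close>.  \<open>At i \<phi>\<close> is the
  satisfaction formula with nominal \<open>i\<close> and body \<open>\<phi>\<close>.\<close>

type_synonym pvar = nat
type_synonym nom = nat

datatype fm =
    Pro pvar
  | Nom nom
  | Neg fm
  | And fm fm
  | Or fm fm
  | Dia fm
  | Box fm
  | At nom fm

fun noms :: "fm \<Rightarrow> nom set" where
  "noms (Pro p) = {}"
| "noms (Nom i) = {i}"
| "noms (Neg \<phi>) = noms \<phi>"
| "noms (And \<phi> \<psi>) = noms \<phi> \<union> noms \<psi>"
| "noms (Or \<phi> \<psi>) = noms \<phi> \<union> noms \<psi>"
| "noms (Dia \<phi>) = noms \<phi>"
| "noms (Box \<phi>) = noms \<phi>"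
| "noms (At i \<phi>) = insert i (noms \<phi>)"

fun subfms :: "fm \<Rightarrow> fm set" where
  "subfms (Pro p) = {Pro p}"
| "subfms (Nom i) = {Nom i}"
| "subfms (Neg \<phi>) = insert (Neg \<phi>) (subfms \<phi>)"
| "subfms (And \<phi> \<psi>) = insert (And \<phi> \<psi>) (subfms \<phi> \<union> subfms \<psi>)"
| "subfms (Or \<phi> \<psi>) = insert (Or \<phi> \<psi>) (subfms \<phi> \<union> subfms \<psi>)"
| "subfms (Dia \<phi>) = insert (Dia \<phi>) (subfms \<phi>)"
| "subfms (Box \<phi>) = insert (Box \<phi>) (subfms \<phi>)"
| "subfms (At i \<phi>) = insert (At i \<phi>) (subfms \<phi>)"

fun is_nnf :: "fm \<Rightarrow> bool" where
  "is_nnf (Pro p) = True"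
| "is_nnf (Nom i) = True"
| "is_nnf (Neg \<phi>) = ((\<exists>p. \<phi> = Pro p) \<or> (\<exists>i. \<phi> = Nom i))"
| "is_nnf (And \<phi> \<psi>) = (is_nnf \<phi> \<and> is_nnf \<psi>)"
| "is_nnf (Or \<phi> \<psi>) = (is_nnf \<phi> \<and> is_nnf \<psi>)"
| "is_nnf (Dia \<phi>) = is_nnf \<phi>"
| "is_nnf (Box \<phi>) = is_nnf \<phi>"
| "is_nnf (At i \<phi>) = is_nnf \<phi>"

text \<open>\<open>nnf \<phi>\<close> is the negation normal form of \<open>\<phi>\<close> and \<open>neg \<phi>\<close>
  that of its negation.\<close>

fun nnf :: "fm \<Rightarrow> fm" and neg :: "fm \<Rightarrow> fm" where
  "nnf (Pro p) = Pro p"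
| "nnf (Nom i) = Nom i"
| "nnf (Neg \<phi>) = neg \<phi>"
| "nnf (And \<phi> \<psi>) = And (nnf \<phi>) (nnf \<psi>)"
| "nnf (Or \<phi> \<psi>) = Or (nnf \<phi>) (nnf \<psi>)"
| "nnf (Dia \<phi>) = Dia (nnf \<phi>)"
| "nnf (Box \<phi>) = Box (nnf \<phi>)"
| "nnf (At i \<phi>) = At i (nnf \<phi>)"
| "neg (Pro p) = Neg (Pro p)"
| "neg (Nom i) = Neg (Nom i)"
| "neg (Neg \<phi>) = nnf \<phi>"
| "neg (And \<phi> \<psi>) = Or (neg \<phi>) (neg \<psi>)"
| "neg (Or \<phi> \<psi>) = And (neg \<phi>) (neg \<psi>)"
| "neg (Dia \<phi>) = Box (neg \<phi>)"
| "neg (Box \<phi>) = Dia (neg \<phi>)"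
| "neg (At i \<phi>) = At i (neg \<phi>)"

lemma is_nnf_nnf: "is_nnf (nnf \<phi>)" and is_nnf_neg: "is_nnf (neg \<phi>)"
  by (induction \<phi> rule: fm.induct) auto

lemma nnf_id: "is_nnf \<phi> \<Longrightarrow> nnf \<phi> = \<phi>"
  by (induction \<phi>) auto

section \<open>Rule instances and branches\<close>

datatype inference =
    EqR nom
  | AndR nom fm fm
  | OrR nom fm fm
  | DiaR nom fm nom
  | BoxR nom fm nom
  | AtR nom nom fm
  | IdR nom fm nom
  | RefR nom
  | ASymR nom
  | TrsR nom fm nom
  | TotR nom nom

definition asym_fm :: "nom \<Rightarrow> fm" where
  "asym_fm i = Box (Or (Nom i) (Box (Neg (Nom i))))"

text \<open>One list of added formulas for each branch that the rule instance produces.\<close>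

fun conclusions :: "inference \<Rightarrow> fm list list" where
  "conclusions (EqR i) = [[At i (Nom i)]]"
| "conclusions (AndR i \<phi> \<psi>) = [[At i \<phi>, At i \<psi>]]"
| "conclusions (OrR i \<phi> \<psi>) = [[At i \<phi>], [At i \<psi>]]"
| "conclusions (DiaR i \<phi> j) = [[At i (Dia (Nom j)), At j \<phi>]]"
| "conclusions (BoxR i \<phi> j) = [[At j \<phi>]]"
| "conclusions (AtR i j \<phi>) = [[At j \<phi>]]"
| "conclusions (IdR i \<phi> j) = [[At j \<phi>]]"
| "conclusions (RefR i) = [[At i (Dia (Nom i))]]"
| "conclusions (ASymR i) = [[At i (asym_fm i)]]"
| "conclusions (TrsR i \<phi> j) = [[At j (Box \<phi>)]]"
| "conclusions (TotR i j) = [[At i (Dia (Nom j))], [At j (Dia (Nom i))]]"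

text \<open>A (finite) branch is its root formula together with the rule instances applied along
  it, in order; each comes with the formulas it added to this particular branch.\<close>

type_synonym branch = "fm \<times> (inference \<times> fm list) list"

definition root_of :: "branch \<Rightarrow> fm" where
  "root_of \<Theta> = fst \<Theta>"

definition applied :: "branch \<Rightarrow> inference set" where
  "applied \<Theta> = fst ` set (snd \<Theta>)"

definition fms :: "branch \<Rightarrow> fm set" where
  "fms \<Theta> = insert (root_of \<Theta>) (\<Union>(r, fs) \<in> set (snd \<Theta>). set fs)"

definition branch_noms :: "branch \<Rightarrow> nom set" where
  "branch_noms \<Theta> = (\<Union>\<phi> \<in> fms \<Theta>. noms \<phi>)"

definition closed_branch :: "branch \<Rightarrow> bool" where
  "closed_branch \<Theta> \<longleftrightarrow> (\<exists>i \<phi>. At i \<phi> \<in> fms \<Theta> \<and> At i (neg \<phi>) \<in> fms \<Theta>)"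

text \<open>Being an accessibility formula depends on how the formula was added to the branch.  Of
  the two formulas added by \<open>DiaR i \<phi> j\<close> only the first one is an accessibility formula,
  even if the second one has the shape \<open>At j (Dia (Nom k))\<close>.\<close>

definition accessibility :: "branch \<Rightarrow> fm \<Rightarrow> bool" where
  "accessibility \<Theta> \<chi> \<longleftrightarrow>
     (\<exists>i \<phi> j. DiaR i \<phi> j \<in> applied \<Theta> \<and> \<chi> = At i (Dia (Nom j)))
   \<or> (\<exists>i. RefR i \<in> applied \<Theta> \<and> \<chi> = At i (Dia (Nom i)))
   \<or> (\<exists>i j fs. (TotR i j, fs) \<in> set (snd \<Theta>) \<and> \<chi> \<in> set fs)"

section \<open>Quasi-urfathers\<close>

fun prefixed_subfm :: "fm \<Rightarrow> fm \<Rightarrow> bool" where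
  "prefixed_subfm (At i \<phi>) (At j \<psi>) \<longleftrightarrow> \<phi> \<in> subfms \<psi>"
| "prefixed_subfm _ _ \<longleftrightarrow> False"

definition T1 :: "branch \<Rightarrow> nom \<Rightarrow> fm set" where
  "T1 \<Theta> i = {\<phi>. At i \<phi> \<in> fms \<Theta> \<and> prefixed_subfm (At i \<phi>) (root_of \<Theta>)}"

definition T2 :: "branch \<Rightarrow> nom \<Rightarrow> fm set" where
  "T2 \<Theta> i = {\<psi>. At i \<psi> \<in> fms \<Theta> \<and>
     (\<exists>j \<in> noms (root_of \<Theta>). prefixed_subfm (At i \<psi>) (At j (asym_fm j)))}"

definition twins :: "branch \<Rightarrow> nom \<Rightarrow> nom \<Rightarrow> bool" where
  "twins \<Theta> i j \<longleftrightarrow> T1 \<Theta> i \<union> T2 \<Theta> i = T1 \<Theta> j \<union> T2 \<Theta> j"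

definition introduces :: "branch \<Rightarrow> (nom \<times> nom) set" where
  "introduces \<Theta> = {(i, j). \<exists>\<phi>. DiaR i \<phi> j \<in> applied \<Theta>}"

definition quasi_urfather :: "branch \<Rightarrow> nom \<Rightarrow> bool" where
  "quasi_urfather \<Theta> i \<longleftrightarrow>
     \<not> (\<exists>j k. j \<noteq> k \<and> twins \<Theta> j k \<and>
          (j, i) \<in> (introduces \<Theta>)\<^sup>* \<and> (k, i) \<in> (introduces \<Theta>)\<^sup>*)"

section \<open>Applicability of the rules\<close>

fun premises_hold :: "branch \<Rightarrow> inference \<Rightarrow> bool" where
  "premises_hold \<Theta> (EqR i) \<longleftrightarrow> i \<in> branch_noms \<Theta>"
| "premises_hold \<Theta> (AndR i \<phi> \<psi>) \<longleftrightarrow> At i (And \<phi> \<psi>) \<in> fms \<Theta>"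
| "premises_hold \<Theta> (OrR i \<phi> \<psi>) \<longleftrightarrow> At i (Or \<phi> \<psi>) \<in> fms \<Theta>"
| "premises_hold \<Theta> (DiaR i \<phi> j) \<longleftrightarrow>
     At i (Dia \<phi>) \<in> fms \<Theta> \<and> \<not> accessibility \<Theta> (At i (Dia \<phi>)) \<and>
     j \<notin> branch_noms \<Theta> \<and> (\<forall>k. DiaR i \<phi> k \<notin> applied \<Theta>) \<and> quasi_urfather \<Theta> i"
| "premises_hold \<Theta> (BoxR i \<phi> j) \<longleftrightarrow>
     At i (Box \<phi>) \<in> fms \<Theta> \<and> At i (Dia (Nom j)) \<in> fms \<Theta>"
| "premises_hold \<Theta> (AtR i j \<phi>) \<longleftrightarrow> At i (At j \<phi>) \<in> fms \<Theta>"
| "premises_hold \<Theta> (IdR i \<phi> j) \<longleftrightarrow>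
     At i \<phi> \<in> fms \<Theta> \<and> \<not> accessibility \<Theta> (At i \<phi>) \<and> At i (Nom j) \<in> fms \<Theta>"
| "premises_hold \<Theta> (RefR i) \<longleftrightarrow> i \<in> branch_noms \<Theta>"
| "premises_hold \<Theta> (ASymR i) \<longleftrightarrow> i \<in> branch_noms \<Theta>"
| "premises_hold \<Theta> (TrsR i \<phi> j) \<longleftrightarrow>
     At i (Box \<phi>) \<in> fms \<Theta> \<and> At i (Dia (Nom j)) \<in> fms \<Theta>"
| "premises_hold \<Theta> (TotR i j) \<longleftrightarrow> i \<in> branch_noms \<Theta> \<and> j \<in> branch_noms \<Theta>"

text \<open>The last conjunct excludes redundant applications; in particular nothing is applicable
  to a branch that already contains every formula the rules could generate.\<close>

definition applicable :: "branch \<Rightarrow> inference \<Rightarrow> bool" where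
  "applicable \<Theta> r \<longleftrightarrow>
     \<not> closed_branch \<Theta> \<and> premises_hold \<Theta> r \<and>
     (\<forall>fs \<in> set (conclusions r). \<not> set fs \<subseteq> fms \<Theta>)"

section \<open>Tableaus\<close>

text \<open>A tableau is a possibly infinite tree.  Nodes are addressed by their path from the root:
  the \<open>k\<close>-th child of node \<open>p\<close> has address \<open>p @ [k]\<close>.  The root node
  \<open>[]\<close> carries the root formula; every other node \<open>q\<close> carries the list
  \<open>added T q\<close> of (at most two) formulas put on its branch by a single rule application.
  \<open>rule_at T p\<close> is the rule instance used to extend the branch ending in \<open>p\<close>; it is
  irrelevant when \<open>p\<close> is a leaf.  A tableau need not be saturated.\<close>

record tableau =
  root_fm :: fm
  nodes :: "nat list set"
  added :: "nat list \<Rightarrow> fm list"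
  rule_at :: "nat list \<Rightarrow> inference"

definition branch_to :: "tableau \<Rightarrow> nat list \<Rightarrow> branch" where
  "branch_to T p =
     (root_fm T, map (\<lambda>n. (rule_at T (take n p), added T (take (Suc n) p))) [0..<length p])"

definition is_leaf :: "tableau \<Rightarrow> nat list \<Rightarrow> bool" where
  "is_leaf T p \<longleftrightarrow> (\<forall>k. p @ [k] \<notin> nodes T)"

definition extended_by_rule :: "tableau \<Rightarrow> nat list \<Rightarrow> bool" where
  "extended_by_rule T p \<longleftrightarrow>
     applicable (branch_to T p) (rule_at T p) \<and>
     (\<forall>k. p @ [k] \<in> nodes T \<longleftrightarrow> k < length (conclusions (rule_at T p))) \<and>
     (\<forall>k < length (conclusions (rule_at T p)).
        added T (p @ [k]) = conclusions (rule_at T p) ! k)"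

definition is_tableau :: "tableau \<Rightarrow> bool" where
  "is_tableau T \<longleftrightarrow>
     [] \<in> nodes T \<and>
     (\<forall>p k. p @ [k] \<in> nodes T \<longrightarrow> p \<in> nodes T) \<and>
     (\<forall>p \<in> nodes T. is_leaf T p \<or> extended_by_rule T p)"

end

theory Submission
  imports Defs
begin

text \<open>A rule other than \<open>[\<Diamond>]\<close> creates no nominals, so the nominals on a branch form a
  forest under \<open>\<prec>\<close> whose roots are the nominals of the root formula.  Only subformulas of the
  root formula trigger \<open>[\<Diamond>]\<close>, each at most once per nominal, which bounds the branching of
  the forest.  If \<open>[\<Diamond>]\<close> is applied to \<open>i\<close>, then the ancestors of \<open>i\<close> have pairwise different
  sets \<open>T\<^sup>\<Theta>\<close>; all of these are subsets of one finite set depending on the root formula only,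
  which bounds the depth.  So the number of nominals, hence that of formulas, hence
  the length of a branch is bounded in terms of the root formula alone, and no appeal to
  Koenig's lemma is needed.\<close>

section \<open>Formulas\<close>

lemma finite_subfms [simp]: "finite (subfms \<phi>)"
  by (induction \<phi>) auto

lemma finite_noms [simp]: "finite (noms \<phi>)"
  by (induction \<phi>) auto

lemma subfms_refl [simp]: "\<phi> \<in> subfms \<phi>"
  by (cases \<phi>) auto

lemma subfms_trans: "\<psi> \<in> subfms \<phi> \<Longrightarrow> \<chi> \<in> subfms \<psi> \<Longrightarrow> \<chi> \<in> subfms \<phi>"
  by (induction \<phi>) auto

lemma subfms_immediate:
  "And \<psi> \<chi> \<in> subfms \<phi> \<Longrightarrow> \<psi> \<in> subfms \<phi>" "And \<psi> \<chi> \<in> subfms \<phi> \<Longrightarrow> \<chi> \<in> subfms \<phi>"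
  "Or \<psi> \<chi> \<in> subfms \<phi> \<Longrightarrow> \<psi> \<in> subfms \<phi>" "Or \<psi> \<chi> \<in> subfms \<phi> \<Longrightarrow> \<chi> \<in> subfms \<phi>"
  "Dia \<psi> \<in> subfms \<phi> \<Longrightarrow> \<psi> \<in> subfms \<phi>" "Box \<psi> \<in> subfms \<phi> \<Longrightarrow> \<psi> \<in> subfms \<phi>"
  "At i \<psi> \<in> subfms \<phi> \<Longrightarrow> \<psi> \<in> subfms \<phi>"
  by (auto elim!: subfms_trans)

lemma subfms_asym_fm:
  "subfms (asym_fm j) =
    {asym_fm j, Or (Nom j) (Box (Neg (Nom j))), Nom j, Box (Neg (Nom j)), Neg (Nom j)}"
  by (auto simp: asym_fm_def)

section \<open>Derivable branches\<close>

definition extend :: "branch \<Rightarrow> inference \<Rightarrow> fm list \<Rightarrow> branch" where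
  "extend \<Theta> r fs = (root_of \<Theta>, snd \<Theta> @ [(r, fs)])"

text \<open>Finite branches are described without reference to a surrounding tableau, so that
  invariants can be proved by induction on the rule applications from the root.\<close>

inductive derivable :: "fm \<Rightarrow> branch \<Rightarrow> bool" for \<chi> where
  root: "derivable \<chi> (\<chi>, [])"
| extend: "derivable \<chi> \<Theta> \<Longrightarrow> applicable \<Theta> r \<Longrightarrow> fs \<in> set (conclusions r) \<Longrightarrow>
    derivable \<chi> (extend \<Theta> r fs)"

lemma extend_simps [simp]:
  "root_of (extend \<Theta> r fs) = root_of \<Theta>"
  "fms (extend \<Theta> r fs) = fms \<Theta> \<union> set fs"
  "applied (extend \<Theta> r fs) = insert r (applied \<Theta>)"
  "branch_noms (extend \<Theta> r fs) = branch_noms \<Theta> \<union> (\<Union>\<phi>\<in>set fs. noms \<phi>)"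
  "set (snd (extend \<Theta> r fs)) = insert (r, fs) (set (snd \<Theta>))"
  by (auto simp: extend_def root_of_def fms_def applied_def branch_noms_def)

lemma root_simps [simp]:
  "root_of (\<chi>, []) = \<chi>" "fms (\<chi>, []) = {\<chi>}" "applied (\<chi>, []) = {}"
  "branch_noms (\<chi>, []) = noms \<chi>" "introduces (\<chi>, []) = {}"
  by (auto simp: root_of_def fms_def applied_def branch_noms_def introduces_def)

lemma introduces_extend_DiaR:
  "introduces (extend \<Theta> (DiaR i \<phi> j) fs) = insert (i, j) (introduces \<Theta>)"
  by (auto simp: introduces_def)

lemma introduces_extend_other:
  "(\<And>i \<phi> j. r \<noteq> DiaR i \<phi> j) \<Longrightarrow> introduces (extend \<Theta> r fs) = introduces \<Theta>"
  by (auto simp: introduces_def)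

lemma accessibility_extend: "accessibility \<Theta> \<chi> \<Longrightarrow> accessibility (extend \<Theta> r fs) \<chi>"
  unfolding accessibility_def by simp blast

lemma finite_fms [simp]: "finite (fms \<Theta>)"
  by (auto simp: fms_def)

lemma finite_branch_noms [simp]: "finite (branch_noms \<Theta>)"
  by (simp add: branch_noms_def)

lemma noms_subset_branch_noms: "\<chi> \<in> fms \<Theta> \<Longrightarrow> noms \<chi> \<subseteq> branch_noms \<Theta>"
  by (auto simp: branch_noms_def)

lemma root_of_derivable: "derivable \<chi> \<Theta> \<Longrightarrow> root_of \<Theta> = \<chi>"
  by (induction rule: derivable.induct) auto

text \<open>Redundant applications are excluded, so each one enlarges the set of formulas; the root
  formula accounts for the strict inequality. Bounding the formulas therefore bounds the
  length.\<close>

lemma length_less_card_fms: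
  assumes "derivable \<chi> \<Theta>"
  shows "length (snd \<Theta>) < card (fms \<Theta>)"
  using assms
proof (induction rule: derivable.induct)
  case (extend \<Theta> r fs)
  then have "fms \<Theta> \<subset> fms \<Theta> \<union> set fs"
    by (auto simp: applicable_def)
  then have "card (fms \<Theta>) < card (fms \<Theta> \<union> set fs)"
    by (intro psubset_card_mono) auto
  then show ?case
    using extend.IH by simp (simp add: extend_def)
qed simp

lemma conclusions_of_derivable:
  "derivable \<chi> \<Theta> \<Longrightarrow> (r, fs) \<in> set (snd \<Theta>) \<Longrightarrow> fs \<in> set (conclusions r)"
  by (induction rule: derivable.induct) auto

text \<open>The clause for \<open>TotR\<close> only says that the formula is in the recorded list,
  so the shape comes from that list being one of the conclusions of the rule. The lemma rules out
  accessibility for premises headed by anything but a diamond.\<close>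

lemma accessibility_shape:
  assumes "derivable \<chi> \<Theta>" and "accessibility \<Theta> \<psi>"
  shows "\<exists>a j. \<psi> = At a (Dia (Nom j))"
  using assms(2) conclusions_of_derivable[OF assms(1)]
  unfolding accessibility_def by fastforce

text \<open>The third alternative refers to the history of the branch rather than to the shape of
  the formula: a formula \<open>@\<^sub>a\<Diamond>j\<close> may also be a subformula of the root formula.\<close>

definition tracked :: "fm \<Rightarrow> branch \<Rightarrow> nom \<Rightarrow> fm \<Rightarrow> bool" where
  "tracked \<phi> \<Theta> a \<psi> \<longleftrightarrow> \<psi> \<in> subfms \<phi>
     \<or> (\<exists>j\<in>branch_noms \<Theta>. \<psi> \<in> subfms (asym_fm j)) \<or> accessibility \<Theta> (At a \<psi>)"

lemma tracked_extend: "tracked \<phi> \<Theta> a \<psi> \<Longrightarrow> tracked \<phi> (extend \<Theta> r fs) a \<psi>"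
  by (auto simp: tracked_def intro: accessibility_extend)

text \<open>A premise of \<open>DiaR\<close> or \<open>IdR\<close> is not an accessibility formula
  by the side condition, and any other compound premise that is decomposed is not one by its shape.
  So conclusions are subformulas of known formulas, except for the new accessibility
  formulas.\<close>

lemma tracked_conclusion:
  assumes der: "derivable \<chi> \<Theta>" and prem: "premises_hold \<Theta> r"
    and fs: "fs \<in> set (conclusions r)" and \<psi>: "\<psi> \<in> set fs"
    and IH: "\<And>a \<psi>. At a \<psi> \<in> fms \<Theta> \<Longrightarrow> tracked \<phi> \<Theta> a \<psi>"
  shows "\<exists>a \<theta>. \<psi> = At a \<theta> \<and> tracked \<phi> (extend \<Theta> r fs) a \<theta>"
proof (cases r)
  case (EqR i)
  \<comment> \<open>\<open>Nom i\<close> is itself a subformula of \<open>asym_fm i\<close>.\<close>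
  then show ?thesis using prem fs \<psi> by (auto simp: tracked_def subfms_asym_fm)
next
  case (AndR i \<alpha> \<beta>)
  then have "tracked \<phi> \<Theta> i (And \<alpha> \<beta>)" using prem IH by simp
  then have "And \<alpha> \<beta> \<in> subfms \<phi>"
    using accessibility_shape[OF der] by (fastforce simp: tracked_def subfms_asym_fm asym_fm_def)
  then show ?thesis using AndR fs \<psi> by (auto simp: tracked_def dest: subfms_immediate)
next
  case (OrR i \<alpha> \<beta>)
  then have "tracked \<phi> \<Theta> i (Or \<alpha> \<beta>)" using prem IH by simp
  \<comment> \<open>Unlike conjunctions, disjunctions do occur in \<open>asym_fm j\<close>, so this
    alternative survives.\<close>
  then have "Or \<alpha> \<beta> \<in> subfms \<phi> \<or> (\<exists>j\<in>branch_noms \<Theta>. Or \<alpha> \<beta> \<in> subfms (asym_fm j))"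
    using accessibility_shape[OF der] by (fastforce simp: tracked_def)
  then have "\<alpha> \<in> subfms \<phi> \<or> (\<exists>j\<in>branch_noms \<Theta>. \<alpha> \<in> subfms (asym_fm j))"
    and "\<beta> \<in> subfms \<phi> \<or> (\<exists>j\<in>branch_noms \<Theta>. \<beta> \<in> subfms (asym_fm j))"
    by (blast dest: subfms_immediate)+
  then show ?thesis using OrR fs \<psi> by (auto simp: tracked_def)
next
  case (DiaR i \<alpha> j)
  then have "tracked \<phi> \<Theta> i (Dia \<alpha>)" "\<not> accessibility \<Theta> (At i (Dia \<alpha>))" using prem IH by simp_all
  then have "Dia \<alpha> \<in> subfms \<phi>"
    by (auto simp: tracked_def subfms_asym_fm asym_fm_def)
  then show ?thesis using DiaR fs \<psi>
    by (auto simp: tracked_def accessibility_def dest: subfms_immediate)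
next
  case (BoxR i \<alpha> j)
  then have "tracked \<phi> \<Theta> i (Box \<alpha>)" using prem IH by simp
  then have "Box \<alpha> \<in> subfms \<phi> \<or> (\<exists>j\<in>branch_noms \<Theta>. Box \<alpha> \<in> subfms (asym_fm j))"
    using accessibility_shape[OF der] by (fastforce simp: tracked_def)
  then have "\<alpha> \<in> subfms \<phi> \<or> (\<exists>j\<in>branch_noms \<Theta>. \<alpha> \<in> subfms (asym_fm j))"
    by (blast dest: subfms_immediate)
  then show ?thesis using BoxR fs \<psi> by (auto simp: tracked_def)
next
  case (AtR i j \<alpha>)
  then have "tracked \<phi> \<Theta> i (At j \<alpha>)" using prem IH by simp
  then have "At j \<alpha> \<in> subfms \<phi>"
    using accessibility_shape[OF der] by (fastforce simp: tracked_def subfms_asym_fm asym_fm_def)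
  then show ?thesis using AtR fs \<psi> by (auto simp: tracked_def dest: subfms_immediate)
next
  case (IdR i \<alpha> j)
  then have "tracked \<phi> \<Theta> i \<alpha>" "\<not> accessibility \<Theta> (At i \<alpha>)" using prem IH by simp_all
  \<comment> \<open>Without accessibility, what remains of \<open>tracked\<close> does not depend on
    the prefix, so it passes from \<open>i\<close> to \<open>j\<close>.\<close>
  then show ?thesis using IdR fs \<psi> by (auto simp: tracked_def)
next
  case (RefR i)
  then show ?thesis using fs \<psi> by (auto simp: tracked_def accessibility_def)
next
  case (ASymR i)
  then show ?thesis using prem fs \<psi> by (auto simp: tracked_def)
next
  case (TrsR i \<alpha> j)
  then have "tracked \<phi> \<Theta> i (Box \<alpha>)" using prem IH by simp
  then have "Box \<alpha> \<in> subfms \<phi> \<or> (\<exists>j\<in>branch_noms \<Theta>. Box \<alpha> \<in> subfms (asym_fm j))"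
    using accessibility_shape[OF der] by (fastforce simp: tracked_def)
  then show ?thesis using TrsR fs \<psi> by (auto simp: tracked_def)
next
  case (TotR i j)
  then have "\<forall>\<chi>\<in>set fs. accessibility (extend \<Theta> r fs) \<chi>"
    unfolding accessibility_def by simp blast
  then show ?thesis using TotR fs \<psi> by (auto simp: tracked_def)
qed

lemma tracked_of_derivable:
  assumes "derivable (At i \<phi>) \<Theta>" and "\<psi> \<in> fms \<Theta>"
  shows "\<exists>a \<theta>. \<psi> = At a \<theta> \<and> tracked \<phi> \<Theta> a \<theta>"
  using assms
proof (induction arbitrary: \<psi> rule: derivable.induct)
  case root
  then show ?case by (simp add: tracked_def)
next
  case (extend \<Theta> r fs)
  then have IH: "tracked \<phi> \<Theta> a \<theta>" if "At a \<theta> \<in> fms \<Theta>" for a \<theta>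
    using that by blast
  show ?case
  proof (cases "\<psi> \<in> fms \<Theta>")
    case True
    then show ?thesis using extend.IH by (blast intro: tracked_extend)
  next
    case False
    then have "\<psi> \<in> set fs" using extend.prems by simp
    with tracked_conclusion[OF extend.hyps(1) _ extend.hyps(3) _ IH] extend.hyps(2)
    show ?thesis by (simp add: applicable_def)
  qed
qed

section \<open>The forest of introduced nominals\<close>

lemma noms_of_conclusion:
  assumes "premises_hold \<Theta> r" and "fs \<in> set (conclusions r)"
    and "\<And>i \<phi> j. r \<noteq> DiaR i \<phi> j"
  shows "(\<Union>\<psi>\<in>set fs. noms \<psi>) \<subseteq> branch_noms \<Theta>"
  using assms by (cases r) (auto simp: asym_fm_def dest!: noms_subset_branch_noms)

lemma branch_noms_extend_other:
  assumes "premises_hold \<Theta> r" and "fs \<in> set (conclusions r)"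
    and "\<And>i \<phi> j. r \<noteq> DiaR i \<phi> j"
  shows "branch_noms (extend \<Theta> r fs) = branch_noms \<Theta>"
  using noms_of_conclusion[OF assms] by auto

lemma branch_noms_extend_DiaR:
  assumes "premises_hold \<Theta> (DiaR i \<phi> j)" and "fs \<in> set (conclusions (DiaR i \<phi> j))"
  shows "branch_noms (extend \<Theta> (DiaR i \<phi> j) fs) = insert j (branch_noms \<Theta>)"
  using assms by (auto dest!: noms_subset_branch_noms)

lemma introduces_subset:
  assumes "derivable \<chi> \<Theta>"
  shows "introduces \<Theta> \<subseteq> branch_noms \<Theta> \<times> branch_noms \<Theta>"
  using assms
proof (induction rule: derivable.induct)
  case (extend \<Theta> r fs)
  then have prem: "premises_hold \<Theta> r" by (simp add: applicable_def)
  show ?case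
  proof (cases "\<exists>i \<phi> j. r = DiaR i \<phi> j")
    case True
    then obtain i \<phi> j where r: "r = DiaR i \<phi> j" by blast
    then have "i \<in> branch_noms \<Theta>" using prem by (auto dest: noms_subset_branch_noms)
    then show ?thesis
      using extend.IH extend.hyps(3) prem unfolding r
      by (auto simp del: extend_simps simp: introduces_extend_DiaR branch_noms_extend_DiaR)
  next
    case False
    then show ?thesis
      using extend.IH by (auto simp: introduces_extend_other)
  qed
qed simp

text \<open>This is the restriction of the diamond rule to one application per formula. It makes the
  introduced nominal a function of its parent and the diamond formula.\<close>

lemma DiaR_functional:
  assumes "derivable \<chi> \<Theta>" "DiaR i \<phi> j \<in> applied \<Theta>" "DiaR i \<phi> k \<in> applied \<Theta>"
  shows "j = k"
  using assms
  by (induction rule: derivable.induct) (auto simp: applicable_def)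

text \<open>Accessibility formulas are barred as premises and \<open>asym_fm j\<close> contains no
  diamond, so only the root formula can supply \<open>Dia \<psi>\<close>.\<close>

lemma DiaR_subfms:
  assumes "derivable (At a \<phi>) \<Theta>" "DiaR i \<psi> j \<in> applied \<Theta>"
  shows "Dia \<psi> \<in> subfms \<phi>"
  using assms
proof (induction rule: derivable.induct)
  case (extend \<Theta> r fs)
  show ?case
  proof (cases "r = DiaR i \<psi> j")
    case True
    then have "At i (Dia \<psi>) \<in> fms \<Theta>" "\<not> accessibility \<Theta> (At i (Dia \<psi>))"
      using extend.hyps by (simp_all add: applicable_def)
    then have "tracked \<phi> \<Theta> i (Dia \<psi>)"
      using tracked_of_derivable[OF extend.hyps(1)] by blast
    then show ?thesis
      using \<open>\<not> accessibility \<Theta> (At i (Dia \<psi>))\<close>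
      by (auto simp: tracked_def subfms_asym_fm asym_fm_def)
  qed (use extend in auto)
qed simp

section \<open>Depth of the forest\<close>

text \<open>One superset of all the sets compared by \<open>twins\<close>. It does not grow with the
  branch, because \<open>T2\<close> only admits \<open>asym_fm j\<close> for nominals
  \<open>j\<close> of the root formula.\<close>

definition T_range :: "fm \<Rightarrow> fm set" where
  "T_range \<chi> = subfms \<chi> \<union> (\<Union>j\<in>noms \<chi>. subfms (asym_fm j))"

lemma finite_T_range [simp]: "finite (T_range \<chi>)"
  by (simp add: T_range_def)

lemma T_subset_T_range: "T1 \<Theta> i \<union> T2 \<Theta> i \<subseteq> T_range (root_of \<Theta>)"
  by (cases "root_of \<Theta>") (auto simp: T1_def T2_def T_range_def)

definition ancestors :: "branch \<Rightarrow> nom \<Rightarrow> nom set" where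
  "ancestors \<Theta> i = {k. (k, i) \<in> (introduces \<Theta>)\<^sup>*}"

lemma ancestors_subset:
  assumes "derivable \<chi> \<Theta>" and "i \<in> branch_noms \<Theta>"
  shows "ancestors \<Theta> i \<subseteq> branch_noms \<Theta>"
  using assms introduces_subset[OF assms(1)]
  by (auto simp: ancestors_def elim: converse_rtranclE)

text \<open>No two ancestors of a quasi-urfather are twins, so mapping an ancestor to its set of
  formulas is injective into the power set of \<open>T_range\<close>.\<close>

lemma card_ancestors_quasi_urfather:
  assumes "quasi_urfather \<Theta> i"
  shows "card (ancestors \<Theta> i) \<le> 2 ^ card (T_range (root_of \<Theta>))"
proof -
  have "inj_on (\<lambda>k. T1 \<Theta> k \<union> T2 \<Theta> k) (ancestors \<Theta> i)"
    using assms unfolding quasi_urfather_def twins_def ancestors_def inj_on_def by blast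
  then have "card (ancestors \<Theta> i) \<le> card (Pow (T_range (root_of \<Theta>)))"
    by (rule card_inj_on_le) (use T_subset_T_range[of \<Theta>] in \<open>blast, simp\<close>)
  then show ?thesis by (simp add: card_Pow)
qed

text \<open>The conjunct \<open>d < card (ancestors \<Theta> a)\<close> serves the induction: when
  \<open>DiaR\<close> is applied to a quasi-urfather, it turns the bound on ancestors into a bound
  on the depth of the new nominal. The depth bound is kept as a separate conjunct because a nominal
  may cease to be a quasi-urfather as the branch grows.\<close>

lemma depth_bound:
  assumes "derivable \<chi> \<Theta>" and "a \<in> branch_noms \<Theta>"
  shows "\<exists>d r. d \<le> 2 ^ card (T_range \<chi>) \<and> r \<in> noms \<chi> \<and> (r, a) \<in> introduces \<Theta> ^^ d
    \<and> d < card (ancestors \<Theta> a)"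
  using assms
proof (induction arbitrary: a rule: derivable.induct)
  case root
  then have "a \<in> noms \<chi>" "ancestors (\<chi>, []) a = {a}" by (auto simp: ancestors_def)
  then show ?case by (intro exI[of _ 0] exI[of _ a]) simp
next
  case (extend \<Theta> r fs)
  then have prem: "premises_hold \<Theta> r" by (simp add: applicable_def)
  show ?case
  proof (cases "\<exists>i \<phi> j. r = DiaR i \<phi> j")
    case False
    then have "introduces (extend \<Theta> r fs) = introduces \<Theta>"
      "branch_noms (extend \<Theta> r fs) = branch_noms \<Theta>"
      using prem extend.hyps(3) introduces_extend_other branch_noms_extend_other by blast+
    then show ?thesis using extend.IH extend.prems by (simp add: ancestors_def)
  next
    case True
    then obtain i \<phi> j where r: "r = DiaR i \<phi> j" by blast
    let ?\<Theta> = "extend \<Theta> r fs"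
    have intr: "introduces ?\<Theta> = insert (i, j) (introduces \<Theta>)"
      by (simp add: r introduces_extend_DiaR)
    then have mono: "introduces \<Theta> \<subseteq> introduces ?\<Theta>" by blast
    have i: "i \<in> branch_noms \<Theta>" and j: "j \<notin> branch_noms \<Theta>" and qu: "quasi_urfather \<Theta> i"
      using prem r by (auto dest: noms_subset_branch_noms)
    have der: "derivable \<chi> ?\<Theta>" using extend.hyps by (rule derivable.extend)
    \<comment> \<open>Monotonicity of \<open>card\<close> needs the larger set to be finite.\<close>
    have fin: "finite (ancestors ?\<Theta> a)"
      using ancestors_subset[OF der extend.prems] finite_branch_noms finite_subset by blast
    have anc: "ancestors \<Theta> b \<subseteq> ancestors ?\<Theta> b" for b
      using rtrancl_mono[OF mono] by (auto simp: ancestors_def)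
    have pow: "introduces \<Theta> ^^ d \<subseteq> introduces ?\<Theta> ^^ d" for d
      by (induction d) (use mono in auto)
    show ?thesis
    proof (cases "a \<in> branch_noms \<Theta>")
      case True
      from extend.IH[OF this] obtain d b where "d \<le> 2 ^ card (T_range \<chi>)" "b \<in> noms \<chi>"
        "(b, a) \<in> introduces \<Theta> ^^ d" "d < card (ancestors \<Theta> a)" by blast
      moreover have "card (ancestors \<Theta> a) \<le> card (ancestors ?\<Theta> a)"
        using fin anc by (rule card_mono)
      ultimately show ?thesis using pow by (meson less_le_trans subsetD)
    next
      case False
      then have a: "a = j"
        using extend.prems branch_noms_extend_DiaR prem extend.hyps(3) r by blast
      from extend.IH[OF i] obtain d b where d: "b \<in> noms \<chi>"
        "(b, i) \<in> introduces \<Theta> ^^ d" "d < card (ancestors \<Theta> i)" by blast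
      then have "(b, j) \<in> introduces ?\<Theta> ^^ Suc d"
        using pow intr by auto
      \<comment> \<open>The restriction to quasi-urfathers enters here: \<open>d\<close> is less
        than the number of ancestors of \<open>i\<close>, which is at most the power of 2.\<close>
      moreover have "Suc d \<le> 2 ^ card (T_range \<chi>)"
        using d(3) card_ancestors_quasi_urfather[OF qu] root_of_derivable[OF extend.hyps(1)]
        by simp
      \<comment> \<open>The fresh \<open>j\<close> is not among the old ancestors of
        \<open>i\<close> but is its own ancestor, so the count rises by one along with the
        depth.\<close>
      moreover have "insert j (ancestors \<Theta> i) \<subseteq> ancestors ?\<Theta> a"
        using anc[of i] intr by (auto simp: ancestors_def a intro: rtrancl_into_rtrancl)
      then have "card (insert j (ancestors \<Theta> i)) \<le> card (ancestors ?\<Theta> a)"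
        using fin by (rule card_mono[rotated])
      then have "Suc d < card (ancestors ?\<Theta> a)"
        using d(3) j ancestors_subset[OF extend.hyps(1) i] finite_subset[OF _ finite_branch_noms]
        by (subst (asm) card_insert_disjoint) (auto)
      ultimately show ?thesis using d(1) a by blast
    qed
  qed
qed

section \<open>Branching of the forest\<close>

lemma card_introduces_Image:
  assumes der: "derivable (At a \<phi>) \<Theta>" and "finite X"
  shows "finite (introduces \<Theta> `` X) \<and> card (introduces \<Theta> `` X) \<le> card X * card (subfms \<phi>)"
proof -
  \<comment> \<open>\<open>f\<close> picks the nominal introduced for a given parent and diamond
    formula. Its values at pairs without an application are arbitrary, which is harmless as only an
    inclusion in the image is used.\<close>
  define f where "f = (\<lambda>(i, \<chi>). SOME j. \<exists>\<psi>. \<chi> = Dia \<psi> \<and> DiaR i \<psi> j \<in> applied \<Theta>)"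
  have "f (i, Dia \<psi>) = j" if "DiaR i \<psi> j \<in> applied \<Theta>" for i \<psi> j
    using that DiaR_functional[OF der] by (auto simp: f_def)
  then have sub: "introduces \<Theta> `` X \<subseteq> f ` (X \<times> subfms \<phi>)"
    using DiaR_subfms[OF der] by (force simp: introduces_def)
  have fin: "finite (X \<times> subfms \<phi>)" using assms by simp
  have "card (introduces \<Theta> `` X) \<le> card (X \<times> subfms \<phi>)"
    using sub fin by (meson card_image_le card_mono finite_imageI le_trans)
  then show ?thesis
    using sub fin by (simp add: card_cartesian_product finite_subset[OF sub])
qed

lemma card_introduces_relpow_Image:
  assumes "derivable (At a \<phi>) \<Theta>" and "finite X"
  shows "finite ((introduces \<Theta> ^^ d) `` X) \<and>
    card ((introduces \<Theta> ^^ d) `` X) \<le> card X * card (subfms \<phi>) ^ d"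
proof (induction d)
  case (Suc d)
  let ?Y = "(introduces \<Theta> ^^ d) `` X"
  have "card (introduces \<Theta> `` ?Y) \<le> card ?Y * card (subfms \<phi>)"
    using card_introduces_Image[OF assms(1)] Suc by blast
  also have "\<dots> \<le> card X * card (subfms \<phi>) ^ d * card (subfms \<phi>)"
    using Suc by (intro mult_right_mono) auto
  finally show ?case
    using card_introduces_Image[OF assms(1)] Suc by (auto simp: relcomp_Image mult_ac)
qed (use assms in simp)

section \<open>Bounds on derivable branches\<close>

lemma card_branch_noms_bounded:
  "\<exists>N. \<forall>\<Theta>. derivable (At a \<phi>) \<Theta> \<longrightarrow> card (branch_noms \<Theta>) \<le> N"
\<comment> \<open>The witness for \<open>N\<close> stays schematic until the end of the chain, a sum
  over the levels up to \<open>?D\<close>; it mentions only \<open>a\<close> and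
  \<open>\<phi>\<close>.\<close>
proof (intro exI allI impI)
  fix \<Theta> assume der: "derivable (At a \<phi>) \<Theta>"
  let ?X = "noms (At a \<phi>)" and ?D = "2 ^ card (T_range (At a \<phi>)) :: nat"
  have "branch_noms \<Theta> \<subseteq> (\<Union>d\<le>?D. (introduces \<Theta> ^^ d) `` ?X)"
    using depth_bound[OF der] by fast
  then have "card (branch_noms \<Theta>) \<le> card (\<Union>d\<le>?D. (introduces \<Theta> ^^ d) `` ?X)"
    using card_introduces_relpow_Image[OF der] by (intro card_mono) auto
  also have "\<dots> \<le> (\<Sum>d\<le>?D. card ((introduces \<Theta> ^^ d) `` ?X))"
    by (rule card_UN_le) simp
  also have "\<dots> \<le> (\<Sum>d\<le>?D. card ?X * card (subfms \<phi>) ^ d)"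
    using card_introduces_relpow_Image[OF der] by (intro sum_mono) auto
  finally show "card (branch_noms \<Theta>) \<le> (\<Sum>d\<le>?D. card ?X * card (subfms \<phi>) ^ d)" .
qed

text \<open>Candidates for what may follow a prefix when \<open>A\<close> is the set of nominals on
  the branch; \<open>Dia (Nom j)\<close> covers the accessibility formulas, replacing the history in
  \<open>tracked\<close> by a shape that can be counted.\<close>

definition bodies :: "fm \<Rightarrow> nom set \<Rightarrow> fm set" where
  "bodies \<phi> A = subfms \<phi> \<union> (\<Union>j\<in>A. insert (Dia (Nom j)) (subfms (asym_fm j)))"

lemma fms_subset:
  assumes der: "derivable (At a \<phi>) \<Theta>"
  shows "fms \<Theta> \<subseteq> (\<lambda>(i, \<psi>). At i \<psi>) ` (branch_noms \<Theta> \<times> bodies \<phi> (branch_noms \<Theta>))"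
proof
  fix \<chi> assume \<chi>: "\<chi> \<in> fms \<Theta>"
  then obtain i \<psi> where "\<chi> = At i \<psi>" "tracked \<phi> \<Theta> i \<psi>"
    using tracked_of_derivable[OF der] by blast
  then have "i \<in> branch_noms \<Theta>" "\<psi> \<in> bodies \<phi> (branch_noms \<Theta>)"
    using noms_subset_branch_noms[OF \<chi>]
    by (auto simp: tracked_def bodies_def dest!: accessibility_shape[OF der])
  with \<open>\<chi> = At i \<psi>\<close>
  show "\<chi> \<in> (\<lambda>(i, \<psi>). At i \<psi>) ` (branch_noms \<Theta> \<times> bodies \<phi> (branch_noms \<Theta>))"
    by force
qed

text \<open>The factor 6 counts the five subformulas of \<open>asym_fm j\<close> together with
  \<open>Dia (Nom j)\<close>.\<close>

lemma card_bodies: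
  assumes "finite A"
  shows "finite (bodies \<phi> A)" and "card (bodies \<phi> A) \<le> card (subfms \<phi>) + card A * 6"
proof -
  let ?F = "\<lambda>j. {Dia (Nom j), asym_fm j, Or (Nom j) (Box (Neg (Nom j))), Nom j,
    Box (Neg (Nom j)), Neg (Nom j)}"
  have eq: "bodies \<phi> A = subfms \<phi> \<union> (\<Union>j\<in>A. ?F j)"
    by (simp add: bodies_def subfms_asym_fm)
  then show "finite (bodies \<phi> A)" using assms by simp
  have "card (\<Union>j\<in>A. ?F j) \<le> (\<Sum>j\<in>A. card (?F j))" using assms by (rule card_UN_le)
  also have "\<dots> \<le> (\<Sum>j\<in>A. 6)"
    by (intro sum_mono) (simp add: card_insert_if)
  finally show "card (bodies \<phi> A) \<le> card (subfms \<phi>) + card A * 6"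
    unfolding eq using card_Un_le[of "subfms \<phi>" "\<Union>j\<in>A. ?F j"] by simp
qed

lemma length_bounded:
  "\<exists>B. \<forall>\<Theta>. derivable (At a \<phi>) \<Theta> \<longrightarrow> length (snd \<Theta>) \<le> B"
proof -
  obtain N where N: "card (branch_noms \<Theta>) \<le> N" if "derivable (At a \<phi>) \<Theta>" for \<Theta>
    using card_branch_noms_bounded by blast
  \<comment> \<open>At most \<open>N\<close> prefixes, each combined with at most
    \<open>card (subfms \<phi>) + N * 6\<close> bodies.\<close>
  have "length (snd \<Theta>) \<le> N * (card (subfms \<phi>) + N * 6)" if der: "derivable (At a \<phi>) \<Theta>" for \<Theta>
  proof -
    let ?A = "branch_noms \<Theta>"
    have "card (fms \<Theta>) \<le> card (?A \<times> bodies \<phi> ?A)"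
      using fms_subset[OF der] card_bodies(1)[OF finite_branch_noms]
      by (meson card_image_le card_mono finite_SigmaI finite_branch_noms finite_imageI le_trans)
    also have "\<dots> = card ?A * card (bodies \<phi> ?A)" by (rule card_cartesian_product)
    also have "\<dots> \<le> N * (card (subfms \<phi>) + N * 6)"
      using N[OF der] card_bodies(2)[OF finite_branch_noms, of \<phi> \<Theta>]
      by (intro mult_mono) auto
    finally show ?thesis using length_less_card_fms[OF der] by simp
  qed
  then show ?thesis by blast
qed

section \<open>Termination\<close>

lemma branch_to_snoc:
  "branch_to T (p @ [k]) = extend (branch_to T p) (rule_at T p) (added T (p @ [k]))"
  by (simp add: branch_to_def extend_def root_of_def)

lemma length_conclusions: "length (conclusions r) \<le> 2"
  by (cases r) auto

lemma derivable_branch_to: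
  assumes T: "is_tableau T" and "p \<in> nodes T"
  shows "derivable (root_fm T) (branch_to T p) \<and> set p \<subseteq> {..<2}"
  using assms(2)
proof (induction p rule: rev_induct)
  case Nil
  show ?case by (simp add: branch_to_def derivable.root)
next
  case (snoc k p)
  then have p: "p \<in> nodes T" using T by (auto simp: is_tableau_def)
  \<comment> \<open>The child \<open>p @ [k]\<close> shows that \<open>p\<close> is not a
    leaf.\<close>
  then have "extended_by_rule T p"
    using T snoc.prems by (auto simp: is_tableau_def is_leaf_def)
  then have "applicable (branch_to T p) (rule_at T p)"
    and "k < length (conclusions (rule_at T p))"
    and "added T (p @ [k]) = conclusions (rule_at T p) ! k"
    using snoc.prems by (auto simp: extended_by_rule_def)
  then show ?case
    using snoc.IH[OF p] length_conclusions[of "rule_at T p"]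
    by (auto simp: branch_to_snoc intro: derivable.extend)
qed

theorem theorem6p2:
  fixes \<phi> :: fm and i :: nom and T :: tableau
  assumes "is_nnf \<phi>"
    and "i \<notin> noms \<phi>"
    and "is_tableau T"
    and "root_fm T = At i \<phi>"
  shows "finite (nodes T)"
proof -
  obtain B where B: "length (snd \<Theta>) \<le> B" if "derivable (At i \<phi>) \<Theta>" for \<Theta>
    using length_bounded by blast
  \<comment> \<open>Addresses are words over two letters of length at most \<open>B\<close>, because
    the length of a node's branch is that of its address.\<close>
  have "nodes T \<subseteq> {p. set p \<subseteq> {..<2} \<and> length p \<le> B}"
    using derivable_branch_to[OF assms(3)] B by (fastforce simp: assms(4) branch_to_def)
  then show ?thesis
    by (rule finite_subset) (rule finite_lists_length_le, simp)
qed

end
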